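(* Let $\mathcal{H}$ be a separable Hilbert space and let $\mathcal{M}$ and $\mathcal{N}$ be two nests on $\mathcal{H}$ such that $d(\mathcal{M},\mathcal{N}) = \gamma < 1$. Then there is a unique order isomorphism $\theta:\mathcal{M}\to\mathcal{N}$ such that $\|\theta-\mathrm{id}\| = \gamma$. Moreover, $\theta$ preserves dimension.
   Context: A nest on a Hilbert space $\mathcal{H}$ is a set $\mathcal{N}$ of closed subspaces of $\mathcal{H}$ which is totally ordered by inclusion, contains $\{0\}$ and $\mathcal{H}$, and is closed under arbitrary intersections and closed linear spans of subsets of $\mathcal{N}$. For a closed subspace $N$, $P_N$ denotes the orthogonal projection onto $N$. The distance between two nests is $$d(\mathcal{M},\mathcal{N}) = \max\Big\{ \sup_{N\in\mathcal{N}}\inf_{M\in\mathcal{M}}\|P_N-P_M\|,\ \sup_{M\in\mathcal{M}}\inf_{N\in\mathcal{N}}\|P_N-P_M\|\Big\}.$$ A map $\theta:\mathcal{M}\to\mathcal{N}$ between nests is an order isomorphism if it is an order-preserving bijection (order being inclusion). For such $\theta$, $\|\theta-\mathrm{id}\| := \sup_{M\in\mathcal{M}}\|P_{\theta(M)}-P_M\|$. The map $\theta$ preserves dimension if $\operatorname{rank}(P_{M_2}-P_{M_1}) = \operatorname{rank}(P_{\theta(M_2)}-P_{\theta(M_1)})$ for all $M_1<M_2$ in $\mathcal{M}$, where rank takes values in $\{0,1,2,\dots\}\cup\{\infty\}$. *)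

theory Defs
  imports "HOL-Analysis.Analysis" "HOL-Library.Extended_Nat"
begin

text \<open>
  The library has no complex Hilbert spaces. The class below adds to a real inner product space
  a complex scalar multiplication and a sesquilinear form (linear in the second argument) whose
  real part is the given real inner product. Definiteness of \<open>cinner\<close>, and the norm and topology it
  induces, are therefore those of \<^class>\<open>real_inner\<close>.
\<close>

class complex_inner = real_inner +
  fixes scaleC :: "complex \<Rightarrow> 'a \<Rightarrow> 'a"
    and cinner :: "'a \<Rightarrow> 'a \<Rightarrow> complex"
  assumes scaleC_add_right: "scaleC a (x + y) = scaleC a x + scaleC a y"
    and scaleC_add_left: "scaleC (a + b) x = scaleC a x + scaleC b x"
    and scaleC_scaleC: "scaleC a (scaleC b x) = scaleC (a * b) x"
    and scaleC_of_real: "scaleC (complex_of_real r) x = scaleR r x"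
    and cinner_commute: "cinner x y = cnj (cinner y x)"
    and cinner_add_right: "cinner x (y + z) = cinner x y + cinner x z"
    and cinner_scaleC_right: "cinner x (scaleC a y) = a * cinner x y"
    and Re_cinner: "Re (cinner x y) = inner x y"

class chilbert_space = complex_inner + complete_space

interpretation complex_vector: vector_space "scaleC :: complex \<Rightarrow> 'a \<Rightarrow> 'a::complex_inner"
proof
  fix x :: 'a
  show "scaleC 1 x = x"
    using scaleC_of_real[of 1 x] by simp
qed (simp_all add: scaleC_add_right scaleC_add_left scaleC_scaleC)

instantiation complex :: chilbert_space
begin

definition scaleC_complex :: "complex \<Rightarrow> complex \<Rightarrow> complex" where
  "scaleC_complex a x = a * x"

definition cinner_complex :: "complex \<Rightarrow> complex \<Rightarrow> complex" where
  "cinner_complex x y = cnj x * y"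

instance
  by standard
    (simp_all add: scaleC_complex_def cinner_complex_def algebra_simps scaleR_conv_of_real
      inner_complex_def)

end

definition orth_proj :: "'a::complex_inner set \<Rightarrow> 'a \<Rightarrow> 'a" where
  "orth_proj N x = (THE y. y \<in> N \<and> (\<forall>z\<in>N. cinner z (x - y) = 0))"

definition nest :: "'a::complex_inner set set \<Rightarrow> bool" where
  "nest \<N> \<longleftrightarrow>
     (\<forall>N\<in>\<N>. complex_vector.subspace N \<and> closed N) \<and>
     (\<forall>M\<in>\<N>. \<forall>N\<in>\<N>. M \<subseteq> N \<or> N \<subseteq> M) \<and>
     {0} \<in> \<N> \<and> UNIV \<in> \<N> \<and>
     (\<forall>\<S>. \<S> \<subseteq> \<N> \<longrightarrow> \<Inter>\<S> \<in> \<N>) \<and>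
     (\<forall>\<S>. \<S> \<subseteq> \<N> \<longrightarrow> closure (complex_vector.span (\<Union>\<S>)) \<in> \<N>)"

definition proj_dist :: "'a::complex_inner set \<Rightarrow> 'a set \<Rightarrow> real" where
  "proj_dist N M = onorm (\<lambda>x. orth_proj N x - orth_proj M x)"

text \<open>
  For nests all index sets below are nonempty and all values lie in \<open>[0, 1]\<close>, so the real-valued
  suprema and infima are the genuine ones.
\<close>

definition nest_dist :: "'a::complex_inner set set \<Rightarrow> 'a set set \<Rightarrow> real" where
  "nest_dist \<M> \<N> =
     max (SUP N\<in>\<N>. INF M\<in>\<M>. proj_dist N M) (SUP M\<in>\<M>. INF N\<in>\<N>. proj_dist N M)"

definition dist_to_id :: "'a::complex_inner set set \<Rightarrow> ('a set \<Rightarrow> 'a set) \<Rightarrow> real" where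
  "dist_to_id \<M> \<theta> = (SUP M\<in>\<M>. proj_dist (\<theta> M) M)"

text \<open>
  Maps \<open>\<M> \<rightarrow> \<N>\<close> are represented by functions that are \<open>undefined\<close> outside \<open>\<M>\<close>, so that equality
  of such functions is equality of maps on \<open>\<M>\<close>.
\<close>

definition nest_iso :: "'a set set \<Rightarrow> 'a set set \<Rightarrow> ('a set \<Rightarrow> 'a set) \<Rightarrow> bool" where
  "nest_iso \<M> \<N> \<theta> \<longleftrightarrow> \<theta> \<in> \<M> \<rightarrow>\<^sub>E \<N> \<and> bij_betw \<theta> \<M> \<N> \<and> mono_on \<M> \<theta>"

definition op_rank :: "('a \<Rightarrow> 'b::complex_inner) \<Rightarrow> enat" where
  "op_rank T =
     (if \<exists>B. finite B \<and> range T \<subseteq> complex_vector.span B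
      then enat (complex_vector.dim (range T)) else \<infinity>)"

definition preserves_dimension ::
    "'a::complex_inner set set \<Rightarrow> ('a set \<Rightarrow> 'a set) \<Rightarrow> bool" where
  "preserves_dimension \<M> \<theta> \<longleftrightarrow>
     (\<forall>M\<^sub>1\<in>\<M>. \<forall>M\<^sub>2\<in>\<M>. M\<^sub>1 \<subset> M\<^sub>2 \<longrightarrow>
        op_rank (\<lambda>x. orth_proj M\<^sub>2 x - orth_proj M\<^sub>1 x) =
        op_rank (\<lambda>x. orth_proj (\<theta> M\<^sub>2) x - orth_proj (\<theta> M\<^sub>1) x))"

end

theory Submission
  imports Defs
begin

text \<open>
  If \<open>\<parallel>P\<^sub>N - P\<^sub>M\<parallel> < 1\<close> then \<open>P\<^sub>M\<close> maps \<open>N\<close> bijectively onto \<open>M\<close>. Two comparable subspaces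
  within distance less than 1 of the same \<open>M\<close> therefore coincide, so every element of one nest has
  exactly one element of the other within distance less than 1, which attains the infimum; this is
  the only candidate for \<open>\<theta>\<close>. Monotonicity follows from \<open>P\<^bsub>M\<^sub>1\<^esub> P\<^bsub>M\<^sub>2\<^esub> = P\<^bsub>M\<^sub>1\<^esub>\<close> for \<open>M\<^sub>1 \<subseteq> M\<^sub>2\<close>,
  and dimensions are compared through the intermediate space \<open>\<theta>(M\<^sub>2) \<inter> M\<^sub>1\<^sup>\<bottom>\<close>.
\<close>

section \<open>Orthogonal projections onto closed complex subspaces\<close>

lemma ex_orthogonal_decomposition:
  fixes N :: "'a::{real_inner,complete_space} set"
  assumes N: "subspace N" and cl: "closed N"
  shows "\<exists>y\<in>N. \<forall>z\<in>N. inner z (x - y) = 0"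
proof -
  define g where "g y = (norm (x - y))\<^sup>2" for y
  define d where "d = (INF y\<in>N. g y)"
  have ne: "N \<noteq> {}" using subspace_0[OF N] by auto
  have bdd: "bdd_below (g ` N)" by (rule bdd_belowI2[of _ 0]) (simp add: g_def)
  have d_le: "d \<le> g y" if "y \<in> N" for y
    unfolding d_def by (rule cINF_lower[OF bdd that])
  have "\<exists>y\<in>N. g y < d + 1 / Suc n" for n
  proof -
    have "(INF y\<in>N. g y) < d + 1 / Suc n" unfolding d_def by simp
    then show ?thesis using cINF_less_iff[OF ne bdd] by blast
  qed
  then obtain y where yN: "y n \<in> N" and yd: "g (y n) < d + 1 / Suc n" for n
    by metis
  \<comment> \<open>The parallelogram law at the midpoint. If \<open>u\<close> and \<open>v\<close>
    nearly minimise \<open>g\<close> over \<open>N\<close>, the midpoint cannot do better than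
    \<open>d\<close>, so \<open>u\<close> and \<open>v\<close> are close; hence a minimising
    sequence is Cauchy.\<close>
  have par: "(norm (u - v))\<^sup>2 = 2 * g u + 2 * g v - 4 * g ((1/2) *\<^sub>R (u + v))" for u v
    unfolding g_def power2_norm_eq_inner
    by (simp add: inner_diff inner_add inner_commute algebra_simps)
  have close: "(norm (y m - y n))\<^sup>2 < 2 / Suc m + 2 / Suc n" for m n
  proof -
    have "(1/2) *\<^sub>R (y m + y n) \<in> N"
      using N yN by (simp add: subspace_add subspace_scale)
    from d_le[OF this] show ?thesis using yd[of m] yd[of n] par[of "y m" "y n"] by simp
  qed
  have "Cauchy y"
  proof (rule CauchyI)
    fix e :: real assume e: "0 < e"
    obtain K where K: "4 / e\<^sup>2 < real K" using reals_Archimedean2 by blast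
    have "norm (y m - y n) < e" if "m \<ge> K" "n \<ge> K" for m n
    proof -
        have *: "2 / real (Suc k) \<le> 2 / Suc K" if "k \<ge> K" for k
        using that by (intro divide_left_mono) auto
      have "(norm (y m - y n))\<^sup>2 < 4 / Suc K"
        using close[of m n] *[OF that(1)] *[OF that(2)] by simp
      also have "\<dots> < e\<^sup>2"
        using K e by (simp add: field_simps)  (smt (verit) zero_less_power)
      finally show ?thesis using e by (simp add: power2_less_imp_less)
    qed
    then show "\<exists>M. \<forall>m\<ge>M. \<forall>n\<ge>M. norm (y m - y n) < e" by blast
  qed
  then obtain l where l: "y \<longlonglongrightarrow> l"
    using Cauchy_convergent convergent_def by blast
  have lN: "l \<in> N" using closed_sequentially[OF cl] yN l by blast
  have "(\<lambda>n. g (y n)) \<longlonglongrightarrow> g l" unfolding g_def by (intro tendsto_intros l)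
  moreover have "(\<lambda>n. d + 1 / Suc n) \<longlonglongrightarrow> d + 0"
    by (intro tendsto_intros LIMSEQ_Suc[OF lim_1_over_n])
  ultimately have "g l \<le> d + 0"
    by (rule LIMSEQ_le) (use yd less_imp_le in blast)
  then have min: "g l \<le> g z" if "z \<in> N" for z using d_le[OF that] by simp
  have "inner z (x - l) = 0" if z: "z \<in> N" for z
  proof (cases "z = 0")
    case False
    \<comment> \<open>This \<open>t\<close> minimises the quadratic function
      \<open>g (l + t *\<^sub>R z)\<close> of \<open>t\<close>. Minimality of \<open>g l\<close>
      then leaves a negated square over \<open>inner z z\<close> as a nonnegative number.\<close>
    define t where "t = inner z (x - l) / inner z z"
    have zz: "inner z z > 0" using False by simp
    have "l + t *\<^sub>R z \<in> N" using N lN z by (simp add: subspace_add subspace_scale)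
    from min[OF this] have "0 \<le> t * t * inner z z - 2 * t * inner z (x - l)"
      unfolding g_def power2_norm_eq_inner
      by (simp add: inner_diff inner_add inner_commute algebra_simps)
    also have "\<dots> = - (inner z (x - l))\<^sup>2 / inner z z"
      using zz by (simp add: t_def power2_eq_square field_simps)
    finally show ?thesis using zz by (simp add: field_simps)
  qed simp
  then show ?thesis using lN by blast
qed

text \<open>The imaginary part of \<open>cinner x y\<close> is the real inner product of
  \<open>scaleC \<i> x\<close> with \<open>y\<close>. A complex subspace contains
  \<open>scaleC \<i> x\<close> along with \<open>x\<close>, so there real and complex orthogonality
  agree and the real decomposition above applies.\<close>

lemma cinner_eq_0_iff:
  "cinner x y = 0 \<longleftrightarrow> inner x y = 0 \<and> inner (scaleC \<i> x) y = 0"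
proof -
  have "cinner (scaleC \<i> x) y = - \<i> * cinner x y"
    by (metis cinner_commute cinner_scaleC_right complex_cnj_cnj complex_cnj_i complex_cnj_mult)
  then have "inner (scaleC \<i> x) y = Im (cinner x y)"
    using Re_cinner[of "scaleC \<i> x" y] by simp
  then show ?thesis using Re_cinner[of x y] by (simp add: complex_eq_iff)
qed

lemma csubspace_imp_subspace: "complex_vector.subspace N \<Longrightarrow> subspace N"
  unfolding subspace_def complex_vector.subspace_def by (metis scaleC_of_real)

lemma csubspace_orthogonal_iff:
  assumes "complex_vector.subspace N"
  shows "(\<forall>z\<in>N. cinner z x = 0) \<longleftrightarrow> (\<forall>z\<in>N. inner z x = 0)"
  using assms by (auto simp: cinner_eq_0_iff complex_vector.subspace_scale)

lemma orth_projI: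
  assumes N: "complex_vector.subspace N" and y: "y \<in> N" "\<And>z. z \<in> N \<Longrightarrow> inner z (x - y) = 0"
  shows "orth_proj N x = y"
  unfolding orth_proj_def
proof (rule the_equality)
  show "y \<in> N \<and> (\<forall>z\<in>N. cinner z (x - y) = 0)"
    using y csubspace_orthogonal_iff[OF N] by blast
next
  fix u assume "u \<in> N \<and> (\<forall>z\<in>N. cinner z (x - u) = 0)"
  then have u: "u \<in> N" "\<forall>z\<in>N. inner z (x - u) = 0"
    using csubspace_orthogonal_iff[OF N] by auto
  \<comment> \<open>Both residuals \<open>x - u\<close> and \<open>x - y\<close> are orthogonal to
    \<open>N\<close>, hence so is their difference \<open>y - u\<close>, which itself lies in
    \<open>N\<close>.\<close>
  have "y - u \<in> N" by (rule complex_vector.subspace_diff[OF N y(1) u(1)])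
  then have "inner (y - u) (x - u) - inner (y - u) (x - y) = 0" using y(2) u(2) by simp
  then have "inner (y - u) (y - u) = 0" by (simp add: inner_diff_right)
  then show "u = y" by simp
qed

definition closed_csubspace :: "'a::complex_inner set \<Rightarrow> bool" where
  "closed_csubspace N \<longleftrightarrow> complex_vector.subspace N \<and> closed N"

lemma closed_csubspaceD: "closed_csubspace N \<Longrightarrow> complex_vector.subspace N"
  by (simp add: closed_csubspace_def)

context
  fixes N :: "'a::chilbert_space set"
  assumes N: "closed_csubspace N"
begin

lemma orth_proj_works: "orth_proj N x \<in> N \<and> (\<forall>z\<in>N. inner z (x - orth_proj N x) = 0)"
proof -
  obtain y where "y \<in> N" "\<forall>z\<in>N. inner z (x - y) = 0"
    using ex_orthogonal_decomposition[of N x] N csubspace_imp_subspace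
    unfolding closed_csubspace_def by blast
  moreover from this have "orth_proj N x = y"
    using N by (intro orth_projI) (auto simp: closed_csubspace_def)
  ultimately show ?thesis by simp
qed

lemma orth_proj_in: "orth_proj N x \<in> N"
  and inner_orth_proj_diff: "z \<in> N \<Longrightarrow> inner z (x - orth_proj N x) = 0"
  using orth_proj_works by auto

lemma orth_proj_ident: "x \<in> N \<Longrightarrow> orth_proj N x = x"
  by (rule orth_projI[OF closed_csubspaceD[OF N]]) auto

lemma orth_proj_add: "orth_proj N (x + y) = orth_proj N x + orth_proj N y"
proof (rule orth_projI[OF closed_csubspaceD[OF N]])
  show "orth_proj N x + orth_proj N y \<in> N"
    by (intro complex_vector.subspace_add closed_csubspaceD[OF N] orth_proj_in)
  fix z assume "z \<in> N"
  from inner_orth_proj_diff[OF this, of x] inner_orth_proj_diff[OF this, of y]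
  show "inner z (x + y - (orth_proj N x + orth_proj N y)) = 0"
    by (simp add: inner_diff_right inner_add_right)
qed

lemma orth_proj_scaleC: "orth_proj N (scaleC a x) = scaleC a (orth_proj N x)"
proof (rule orth_projI[OF closed_csubspaceD[OF N]])
  show "scaleC a (orth_proj N x) \<in> N"
    by (intro complex_vector.subspace_scale closed_csubspaceD[OF N] orth_proj_in)
  fix z assume z: "z \<in> N"
  \<comment> \<open>Real orthogonality to the single vector \<open>z\<close> need not survive
    multiplication by a complex scalar; orthogonality to all of \<open>N\<close> gives the complex
    form, which does.\<close>
  have "cinner z (x - orth_proj N x) = 0"
    using inner_orth_proj_diff csubspace_orthogonal_iff[OF closed_csubspaceD[OF N]] z by blast
  then have "cinner z (scaleC a (x - orth_proj N x)) = 0"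
    by (simp add: cinner_scaleC_right)
  then show "inner z (scaleC a x - scaleC a (orth_proj N x)) = 0"
    by (simp add: cinner_eq_0_iff complex_vector.scale_right_diff_distrib)
qed

lemma clinear_orth_proj: "Vector_Spaces.linear scaleC scaleC (orth_proj N)"
  by unfold_locales (simp_all add: orth_proj_add orth_proj_scaleC)

lemma orth_proj_0: "orth_proj N 0 = 0"
  by (rule orth_proj_ident) (rule complex_vector.subspace_0[OF closed_csubspaceD[OF N]])

lemma orth_proj_diff: "orth_proj N (x - y) = orth_proj N x - orth_proj N y"
  using orth_proj_add[of "x - y" y] by (simp add: algebra_simps)

lemma orth_proj_scaleR: "orth_proj N (r *\<^sub>R x) = r *\<^sub>R orth_proj N x"
  using orth_proj_scaleC[of "of_real r" x] by (simp add: scaleC_of_real)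

lemma norm_orth_proj_le: "norm (orth_proj N x) \<le> norm x"
proof -
  have "inner (orth_proj N x) (x - orth_proj N x) = 0"
    by (rule inner_orth_proj_diff[OF orth_proj_in])
  then have "(norm x)\<^sup>2 = (norm (orth_proj N x))\<^sup>2 + (norm (x - orth_proj N x))\<^sup>2"
    unfolding power2_norm_eq_inner by (simp add: inner_diff inner_commute)
  then show ?thesis by (smt (verit) norm_ge_zero power2_le_imp_le zero_le_power2)
qed

lemma bounded_linear_orth_proj: "bounded_linear (orth_proj N)"
  by (rule bounded_linear_intro[of _ 1])
    (simp_all add: orth_proj_add orth_proj_scaleR norm_orth_proj_le)

end

lemma orth_proj_compose:
  fixes M N :: "'a::chilbert_space set"
  assumes N: "closed_csubspace N" and M: "closed_csubspace M" and "M \<subseteq> N"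
  shows "orth_proj M (orth_proj N x) = orth_proj M x"
proof (rule orth_projI[OF closed_csubspaceD[OF M] orth_proj_in[OF M], symmetric])
  fix z assume z: "z \<in> M"
  with \<open>M \<subseteq> N\<close> have "z \<in> N" by blast
  from inner_orth_proj_diff[OF M z, of "orth_proj N x"] inner_orth_proj_diff[OF N this, of x]
  show "inner z (x - orth_proj M (orth_proj N x)) = 0"
    by (simp add: inner_diff_right)
qed

section \<open>Norm distance between projections\<close>

lemma bounded_linear_orth_proj_diff:
  fixes M N :: "'a::chilbert_space set"
  assumes "closed_csubspace M" "closed_csubspace N"
  shows "bounded_linear (\<lambda>x. orth_proj N x - orth_proj M x)"
  using assms by (intro bounded_linear_sub bounded_linear_orth_proj)

lemma norm_orth_proj_diff_le:
  fixes M N :: "'a::chilbert_space set"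
  assumes "closed_csubspace M" "closed_csubspace N"
  shows "norm (orth_proj N x - orth_proj M x) \<le> proj_dist N M * norm x"
  unfolding proj_dist_def by (rule onorm[OF bounded_linear_orth_proj_diff[OF assms]])

lemma proj_dist_nonneg:
  fixes M N :: "'a::chilbert_space set"
  assumes "closed_csubspace M" "closed_csubspace N"
  shows "0 \<le> proj_dist N M"
  unfolding proj_dist_def by (rule onorm_pos_le[OF bounded_linear_orth_proj_diff[OF assms]])

text \<open>The crude triangle bound suffices: it serves only to make the real suprema over a nest
  bounded above.\<close>

lemma proj_dist_le_2:
  fixes M N :: "'a::chilbert_space set"
  assumes "closed_csubspace M" "closed_csubspace N"
  shows "proj_dist N M \<le> 2"
  unfolding proj_dist_def
proof (rule onorm_bound)
  fix x
  show "norm (orth_proj N x - orth_proj M x) \<le> 2 * norm x"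
    using norm_triangle_ineq4[of "orth_proj N x" "orth_proj M x"]
      norm_orth_proj_le[OF assms(1), of x] norm_orth_proj_le[OF assms(2), of x] by simp
qed simp

lemma proj_dist_commute: "proj_dist N M = proj_dist M N"
  unfolding proj_dist_def onorm_def by (simp add: norm_minus_commute)

text \<open>On \<open>N\<close> the projection onto \<open>M\<close> moves \<open>x\<close> by at
  most \<open>c * norm x\<close> with \<open>c < 1\<close>, so it kills no nonzero vector of
  \<open>N\<close>. Surjectivity comes from a contraction on the complete space
  \<open>M\<close>.\<close>

lemma bij_betw_orth_proj:
  fixes M N :: "'a::chilbert_space set"
  assumes M: "closed_csubspace M" and N: "closed_csubspace N" and less: "proj_dist N M < 1"
  shows "bij_betw (orth_proj M) N M"
  unfolding bij_betw_def
proof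
  define c where "c = proj_dist N M"
  have c: "0 \<le> c" "c < 1" using less proj_dist_nonneg[OF M N] by (auto simp: c_def)
  have le: "norm (orth_proj N x - orth_proj M x) \<le> c * norm x" for x
    unfolding c_def by (rule norm_orth_proj_diff_le[OF M N])
  show "inj_on (orth_proj M) N"
  proof (rule inj_onI)
    fix x y assume xy: "x \<in> N" "y \<in> N" "orth_proj M x = orth_proj M y"
    have "x - y \<in> N" by (rule complex_vector.subspace_diff[OF closed_csubspaceD[OF N] xy(1,2)])
    with le[of "x - y"] xy(3) have "norm (x - y) \<le> c * norm (x - y)"
      by (simp add: orth_proj_diff[OF M] orth_proj_ident[OF N])
    then have "(1 - c) * norm (x - y) \<le> 0" by (simp add: algebra_simps)
    with c show "x = y" by (simp add: mult_le_0_iff)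
  qed
  show "orth_proj M ` N = M"
  proof
    show "orth_proj M ` N \<subseteq> M" using orth_proj_in[OF M] by auto
    show "M \<subseteq> orth_proj M ` N"
    proof
      fix m assume m: "m \<in> M"
      define T where "T u = m + u - orth_proj M (orth_proj N u)" for u
      \<comment> \<open>A fixed point of \<open>T\<close> is a preimage of \<open>m\<close> under \<open>P\<^sub>M P\<^sub>N\<close>, which is within \<open>c < 1\<close> of the identity on \<open>M\<close>.\<close>
      have "\<exists>!u\<in>M. T u = u"
      proof (rule Banach_fix[OF _ _ c])
        show "complete M" using M by (simp add: closed_csubspace_def complete_eq_closed)
        show "M \<noteq> {}" using m by blast
        show "T ` M \<subseteq> M"
          unfolding T_def using m orth_proj_in[OF M] closed_csubspaceD[OF M]
          by (auto intro!: complex_vector.subspace_add complex_vector.subspace_diff)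
        fix u v assume uv: "u \<in> M" "v \<in> M"
        \<comment> \<open>The vector \<open>m\<close> cancels, and \<open>u - v\<close> in
          \<open>M\<close> is fixed by the projection onto \<open>M\<close>, which brings in the
          difference of the two projections.\<close>
        have "T u - T v = orth_proj M (orth_proj M (u - v) - orth_proj N (u - v))"
          unfolding T_def orth_proj_diff[OF M] orth_proj_diff[OF N]
          by (simp add: orth_proj_ident[OF M] orth_proj_in[OF M] uv)
        also have "norm \<dots> \<le> norm (orth_proj M (u - v) - orth_proj N (u - v))"
          by (rule norm_orth_proj_le[OF M])
        also have "\<dots> \<le> c * norm (u - v)" using le by (simp add: norm_minus_commute)
        finally show "dist (T u) (T v) \<le> c * dist u v" by (simp add: dist_norm)
      qed
      then obtain u where "T u = u" by blast
      then have "m = orth_proj M (orth_proj N u)" unfolding T_def by (simp add: algebra_simps)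
      then show "m \<in> orth_proj M ` N" using orth_proj_in[OF N] by blast
    qed
  qed
qed

section \<open>Ranks of differences of projections\<close>

lemma op_rank_eq_basis:
  assumes B: "\<not> complex_vector.dependent B" and T: "range T = complex_vector.span B"
  shows "op_rank T = (if finite B then enat (card B) else \<infinity>)"
proof -
  \<comment> \<open>An independent set inside the span of a finite set is finite, so the case
    distinction in \<open>op_rank\<close> is decided by any algebraic basis of the range.\<close>
  have "finite B" if "finite C" "complex_vector.span B \<subseteq> complex_vector.span C" for C
    using complex_vector.independent_span_bound[OF that(1) B] that(2)
      complex_vector.span_superset by blast
  then have "(\<exists>C. finite C \<and> range T \<subseteq> complex_vector.span C) \<longleftrightarrow> finite B"
    unfolding T by blast
  then show ?thesis
    unfolding op_rank_def T using complex_vector.dim_eq_card_independent[OF B] by simp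
qed

lemma op_rank_linear_image:
  fixes f :: "'a::complex_inner \<Rightarrow> 'b::complex_inner"
  assumes f: "Vector_Spaces.linear scaleC scaleC f"
    and V: "complex_vector.subspace V" and inj: "inj_on f V"
    and S: "range S = V" and T: "range T = f ` V"
  shows "op_rank T = op_rank S"
proof -
  interpret f: Vector_Spaces.linear scaleC scaleC f by fact
  obtain B where B: "B \<subseteq> V" "\<not> complex_vector.dependent B" "V \<subseteq> complex_vector.span B"
    by (rule complex_vector.basis_exists)
  have span: "complex_vector.span B = V"
    using B complex_vector.span_minimal[OF B(1) V] by blast
  have "\<not> complex_vector.dependent (f ` B)"
    using f.independent_inj_on_image[OF B(2)] inj span by simp
  then have "op_rank T = (if finite (f ` B) then enat (card (f ` B)) else \<infinity>)"
    by (rule op_rank_eq_basis) (simp add: T f.span_image span)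
  moreover have "inj_on f B" using inj B(1) by (rule inj_on_subset)
  ultimately show ?thesis
    using op_rank_eq_basis[OF B(2), of S] S span by (simp add: card_image finite_image_iff)
qed

text \<open>
  Both ranges are isomorphic to \<open>K = N\<^sub>2 \<inter> M\<^sub>1\<^sup>\<bottom>\<close>: projecting to \<open>M\<^sub>2\<close> maps \<open>K\<close> onto
  \<open>M\<^sub>2 \<ominus> M\<^sub>1\<close>, and \<open>N\<^sub>2 = N\<^sub>1 \<oplus> K\<close> as an algebraic direct sum.
\<close>

lemma op_rank_diff_eq:
  fixes M\<^sub>1 M\<^sub>2 N\<^sub>1 N\<^sub>2 :: "'a::chilbert_space set"
  assumes M1: "closed_csubspace M\<^sub>1" and M2: "closed_csubspace M\<^sub>2" and M: "M\<^sub>1 \<subseteq> M\<^sub>2"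
    and N1: "closed_csubspace N\<^sub>1" and N2: "closed_csubspace N\<^sub>2" and N: "N\<^sub>1 \<subseteq> N\<^sub>2"
    and b1: "bij_betw (orth_proj M\<^sub>1) N\<^sub>1 M\<^sub>1" and b2: "bij_betw (orth_proj M\<^sub>2) N\<^sub>2 M\<^sub>2"
  shows "op_rank (\<lambda>x. orth_proj M\<^sub>2 x - orth_proj M\<^sub>1 x) =
    op_rank (\<lambda>x. orth_proj N\<^sub>2 x - orth_proj N\<^sub>1 x)"
proof -
  define K where "K = {x \<in> N\<^sub>2. orth_proj M\<^sub>1 x = 0}"
  define g where "g x = x - orth_proj N\<^sub>1 x" for x
  have K: "complex_vector.subspace K"
    using closed_csubspaceD[OF N2] unfolding K_def complex_vector.subspace_def
    by (simp add: orth_proj_0[OF M1] orth_proj_add[OF M1] orth_proj_scaleC[OF M1])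
  have 0: "0 \<in> N\<^sub>1" by (rule complex_vector.subspace_0[OF closed_csubspaceD[OF N1]])
  \<comment> \<open>Any map with range \<open>K\<close> will do; \<open>S\<close> stands for
    \<open>K\<close> as an argument of \<open>op_rank\<close>.\<close>
  obtain S :: "'a \<Rightarrow> 'a" where S: "range S = K"
  proof
    show "range (\<lambda>x. if x \<in> K then x else 0) = K"
      using complex_vector.subspace_0[OF K] by (auto simp: image_iff)
  qed
  have rM: "range (\<lambda>x. orth_proj M\<^sub>2 x - orth_proj M\<^sub>1 x) = orth_proj M\<^sub>2 ` K" (is "range ?T = _")
  proof
    show "range ?T \<subseteq> orth_proj M\<^sub>2 ` K"
    proof clarify
      fix x
      have "?T x \<in> M\<^sub>2" using M orth_proj_in[OF M1] orth_proj_in[OF M2]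
        by (blast intro: complex_vector.subspace_diff[OF closed_csubspaceD[OF M2]])
      then obtain n where n: "n \<in> N\<^sub>2" "orth_proj M\<^sub>2 n = ?T x"
        using b2 by (metis bij_betw_imp_surj_on imageE)
      \<comment> \<open>The preimage \<open>n\<close> lies in \<open>K\<close>: projecting to
        \<open>M\<^sub>1\<close> factors through \<open>M\<^sub>2\<close>, and \<open>?T x\<close>
        is orthogonal to \<open>M\<^sub>1\<close>.\<close>
      have "orth_proj M\<^sub>1 n = orth_proj M\<^sub>1 (?T x)"
        using orth_proj_compose[OF M2 M1 M, of n] n(2) by simp
      also have "\<dots> = 0"
        by (simp add: orth_proj_diff[OF M1] orth_proj_compose[OF M2 M1 M]
            orth_proj_ident[OF M1 orth_proj_in[OF M1]])
      finally show "?T x \<in> orth_proj M\<^sub>2 ` K"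
        using n by (metis (mono_tags, lifting) K_def imageI mem_Collect_eq)
    qed
    show "orth_proj M\<^sub>2 ` K \<subseteq> range ?T"
    proof clarify
      fix k assume "k \<in> K"
      then have "orth_proj M\<^sub>2 k = ?T k" by (simp add: K_def)
      then show "orth_proj M\<^sub>2 k \<in> range ?T" by (rule range_eqI)
    qed
  qed
  have rN: "range (\<lambda>x. orth_proj N\<^sub>2 x - orth_proj N\<^sub>1 x) = g ` K" (is "range ?T = _")
  proof
    show "range ?T \<subseteq> g ` K"
    proof clarify
      fix x
      have y: "?T x \<in> N\<^sub>2" using N orth_proj_in[OF N1] orth_proj_in[OF N2]
        by (blast intro: complex_vector.subspace_diff[OF closed_csubspaceD[OF N2]])
      have Py: "orth_proj N\<^sub>1 (?T x) = 0"
        by (simp add: orth_proj_diff[OF N1] orth_proj_compose[OF N2 N1 N]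
            orth_proj_ident[OF N1 orth_proj_in[OF N1]])
      \<comment> \<open>Subtracting this \<open>n\<close> moves \<open>?T x\<close> into
        \<open>K\<close> without changing its image under \<open>g\<close>, because \<open>g\<close>
        vanishes on \<open>N\<^sub>1\<close> and fixes \<open>?T x\<close>.\<close>
      obtain n where n: "n \<in> N\<^sub>1" "orth_proj M\<^sub>1 n = orth_proj M\<^sub>1 (?T x)"
        using b1 orth_proj_in[OF M1] by (metis bij_betw_imp_surj_on imageE)
      have "?T x - n \<in> K"
        using y n N complex_vector.subspace_diff[OF closed_csubspaceD[OF N2]]
        by (auto simp: K_def orth_proj_diff[OF M1])
      moreover have "g (?T x - n) = ?T x"
        unfolding g_def orth_proj_diff[OF N1, of "?T x" n] Py orth_proj_ident[OF N1 n(1)] by simp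
      ultimately show "?T x \<in> g ` K" by (metis imageI)
    qed
    show "g ` K \<subseteq> range ?T"
    proof clarify
      fix k assume "k \<in> K"
      then have "g k = ?T k" by (simp add: K_def g_def orth_proj_ident[OF N2])
      then show "g k \<in> range ?T" by (rule range_eqI)
    qed
  qed
  have "inj_on (orth_proj M\<^sub>2) K"
    using b2 by (auto simp: K_def bij_betw_def intro: inj_on_subset)
  then have "op_rank (\<lambda>x. orth_proj M\<^sub>2 x - orth_proj M\<^sub>1 x) = op_rank S"
    by (rule op_rank_linear_image[OF clinear_orth_proj[OF M2] K _ S rM])
  moreover have "Vector_Spaces.linear scaleC scaleC g"
    by unfold_locales (simp_all add: g_def orth_proj_add[OF N1] orth_proj_scaleC[OF N1]
        complex_vector.scale_right_diff_distrib)
  moreover have "inj_on g K"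
  proof (rule inj_onI)
    fix x y assume xy: "x \<in> K" "y \<in> K" "g x = g y"
    \<comment> \<open>The kernel of \<open>g\<close> is \<open>N\<^sub>1\<close>, and it meets
      \<open>K\<close> only in 0, since the projection onto \<open>M\<^sub>1\<close> is injective on
      \<open>N\<^sub>1\<close> and zero on \<open>K\<close>.\<close>
    then have "orth_proj N\<^sub>1 (x - y) = x - y"
      by (simp add: g_def orth_proj_diff[OF N1] algebra_simps)
    then have "x - y \<in> N\<^sub>1" using orth_proj_in[OF N1] by metis
    moreover have "orth_proj M\<^sub>1 (x - y) = orth_proj M\<^sub>1 0"
      using xy by (simp add: K_def orth_proj_diff[OF M1] orth_proj_0[OF M1])
    ultimately have "x - y = 0" using b1 0 by (meson bij_betw_def inj_onD)
    then show "x = y" by simp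
  qed
  ultimately show ?thesis
    using op_rank_linear_image[OF _ K _ S rN] by simp
qed

section \<open>Subspaces at distance less than one\<close>

lemma proj_dist_less_1_unique:
  fixes M N\<^sub>1 N\<^sub>2 :: "'a::chilbert_space set"
  assumes M: "closed_csubspace M" and N1: "closed_csubspace N\<^sub>1" and N2: "closed_csubspace N\<^sub>2"
    and "N\<^sub>1 \<subseteq> N\<^sub>2 \<or> N\<^sub>2 \<subseteq> N\<^sub>1" and "proj_dist N\<^sub>1 M < 1" "proj_dist N\<^sub>2 M < 1"
  shows "N\<^sub>1 = N\<^sub>2"
  \<comment> \<open>The projection onto \<open>M\<close> is injective on the larger of the two
    spaces and gives both the same image \<open>M\<close>.\<close>
  using bij_betw_orth_proj[OF M N1] bij_betw_orth_proj[OF M N2] assms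
  by (metis bij_betw_def inj_on_image_eq_iff order_refl)

text \<open>In the case \<open>N\<^sub>2 \<subseteq> N\<^sub>1\<close>, the projection onto
  \<open>M\<^sub>1\<close> already maps \<open>N\<^sub>2\<close> onto \<open>M\<^sub>1\<close>,
  through \<open>M\<^sub>2\<close>. Being injective on \<open>N\<^sub>1\<close>, it forces the two
  spaces to be equal.\<close>

lemma proj_dist_less_1_mono:
  fixes M\<^sub>1 M\<^sub>2 N\<^sub>1 N\<^sub>2 :: "'a::chilbert_space set"
  assumes M1: "closed_csubspace M\<^sub>1" and M2: "closed_csubspace M\<^sub>2" and M: "M\<^sub>1 \<subseteq> M\<^sub>2"
    and N1: "closed_csubspace N\<^sub>1" and N2: "closed_csubspace N\<^sub>2"
    and N: "N\<^sub>1 \<subseteq> N\<^sub>2 \<or> N\<^sub>2 \<subseteq> N\<^sub>1" and "proj_dist N\<^sub>1 M\<^sub>1 < 1" "proj_dist N\<^sub>2 M\<^sub>2 < 1"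
  shows "N\<^sub>1 \<subseteq> N\<^sub>2"
  using N
proof
  assume sub: "N\<^sub>2 \<subseteq> N\<^sub>1"
  have b1: "bij_betw (orth_proj M\<^sub>1) N\<^sub>1 M\<^sub>1" and b2: "bij_betw (orth_proj M\<^sub>2) N\<^sub>2 M\<^sub>2"
    using assms bij_betw_orth_proj by blast+
  have "M\<^sub>1 = orth_proj M\<^sub>1 ` M\<^sub>1" by (simp add: orth_proj_ident[OF M1])
  also have "\<dots> \<subseteq> orth_proj M\<^sub>1 ` M\<^sub>2" using M by blast
  also have "\<dots> = orth_proj M\<^sub>1 ` orth_proj M\<^sub>2 ` N\<^sub>2" using b2 by (simp add: bij_betw_def)
  also have "\<dots> = orth_proj M\<^sub>1 ` N\<^sub>2" by (simp add: image_image orth_proj_compose[OF M2 M1 M])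
  finally have "orth_proj M\<^sub>1 ` N\<^sub>1 \<subseteq> orth_proj M\<^sub>1 ` N\<^sub>2" using b1 by (simp add: bij_betw_def)
  then show ?thesis using b1 sub inj_on_image_subset_iff[of _ "N\<^sub>1" "N\<^sub>1" "N\<^sub>2"]
    unfolding bij_betw_def by blast
qed

section \<open>Nearest elements in nests\<close>

lemma nest_closed_csubspace: "nest \<N> \<Longrightarrow> N \<in> \<N> \<Longrightarrow> closed_csubspace N"
  by (simp add: nest_def closed_csubspace_def)

lemma nest_total: "nest \<N> \<Longrightarrow> M \<in> \<N> \<Longrightarrow> N \<in> \<N> \<Longrightarrow> M \<subseteq> N \<or> N \<subseteq> M"
  by (simp add: nest_def)

lemma nest_not_empty: "nest \<N> \<Longrightarrow> \<N> \<noteq> {}"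
  by (auto simp: nest_def)

lemma nest_dist_commute: "nest_dist \<M> \<N> = nest_dist \<N> \<M>"
  unfolding nest_dist_def by (simp add: proj_dist_commute max.commute)

context
  fixes \<M> \<N> :: "'a::chilbert_space set set"
  assumes \<M>: "nest \<M>" and \<N>: "nest \<N>"
begin

lemma nest_near_unique:
  assumes "M \<in> \<M>" "N\<^sub>1 \<in> \<N>" "N\<^sub>2 \<in> \<N>" "proj_dist N\<^sub>1 M < 1" "proj_dist N\<^sub>2 M < 1"
  shows "N\<^sub>1 = N\<^sub>2"
  by (rule proj_dist_less_1_unique[of M])
    (use assms \<M> \<N> nest_closed_csubspace nest_total in blast)+

text \<open>Every other element of \<open>\<N>\<close> is at distance at least 1 from
  \<open>M\<close>, so the infimum is a minimum.\<close>

lemma INF_proj_dist_eq: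
  assumes "M \<in> \<M>" "N \<in> \<N>" "proj_dist N M < 1"
  shows "(INF N\<in>\<N>. proj_dist N M) = proj_dist N M"
proof (rule cInf_eq_minimum)
  fix d assume "d \<in> (\<lambda>N. proj_dist N M) ` \<N>"
  then obtain N' where N': "N' \<in> \<N>" "d = proj_dist N' M" by blast
  show "proj_dist N M \<le> d"
    using nest_near_unique[OF assms(1) N'(1) assms(2)] assms(3) N'(2) by force
qed (use assms in blast)

lemma nest_near_exists:
  assumes less: "nest_dist \<M> \<N> < 1" and M: "M \<in> \<M>"
  shows "\<exists>N\<in>\<N>. proj_dist N M < 1"
proof -
  have csub: "closed_csubspace M'" if "M' \<in> \<M> \<or> M' \<in> \<N>" for M'
    using that \<M> \<N> nest_closed_csubspace by blast
  have bdd: "bdd_below ((\<lambda>N. proj_dist N M') ` \<N>)" if "M' \<in> \<M>" for M'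
    using that by (intro bdd_belowI2[of _ 0] proj_dist_nonneg csub) auto
  obtain N where N: "N \<in> \<N>" using nest_not_empty[OF \<N>] by blast
  have "(INF N\<in>\<N>. proj_dist N M') \<le> 2" if "M' \<in> \<M>" for M'
    using cINF_lower[OF bdd[OF that] N] proj_dist_le_2[of M' N] csub that N by force
  then have "bdd_above ((\<lambda>M. INF N\<in>\<N>. proj_dist N M) ` \<M>)" by (rule bdd_aboveI2)
  then have "(INF N\<in>\<N>. proj_dist N M) \<le> nest_dist \<M> \<N>"
    unfolding nest_dist_def using M by (intro max.coboundedI2 cSUP_upper)
  with less have "(INF N\<in>\<N>. proj_dist N M) < 1" by simp
  then show ?thesis using cINF_less_iff[OF _ bdd[OF M]] N by blast
qed

end

lemma proj_dist_le_dist_to_id: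
  fixes \<M> \<N> :: "'a::chilbert_space set set"
  assumes "nest \<M>" "nest \<N>" and \<theta>: "\<theta> ` \<M> \<subseteq> \<N>" and M: "M \<in> \<M>"
  shows "proj_dist (\<theta> M) M \<le> dist_to_id \<M> \<theta>"
  unfolding dist_to_id_def
proof (rule cSUP_upper[OF M], rule bdd_aboveI2)
  fix M assume "M \<in> \<M>"
  then show "proj_dist (\<theta> M) M \<le> 2"
    using assms by (intro proj_dist_le_2) (auto dest: nest_closed_csubspace)
qed

theorem theorem3p1:
  fixes \<M> \<N> :: "'a::chilbert_space set set" and \<gamma> :: real
  assumes "separable_space (euclidean :: 'a topology)"
    and "nest \<M>" and "nest \<N>"
    and "nest_dist \<M> \<N> = \<gamma>" and "\<gamma> < 1"
  shows "(\<exists>!\<theta>. nest_iso \<M> \<N> \<theta> \<and> dist_to_id \<M> \<theta> = \<gamma>) \<and>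
    (\<forall>\<theta>. nest_iso \<M> \<N> \<theta> \<and> dist_to_id \<M> \<theta> = \<gamma> \<longrightarrow> preserves_dimension \<M> \<theta>)"
proof -
  note \<M> = assms(2) and \<N> = assms(3)
  have less: "nest_dist \<M> \<N> < 1" "nest_dist \<N> \<M> < 1"
    using assms(4,5) nest_dist_commute[of \<M> \<N>] by simp_all
  have csubM: "closed_csubspace M" if "M \<in> \<M>" for M
    by (rule nest_closed_csubspace[OF \<M> that])
  have csubN: "closed_csubspace N" if "N \<in> \<N>" for N
    by (rule nest_closed_csubspace[OF \<N> that])
  obtain \<theta>\<^sub>0 where \<theta>\<^sub>0: "\<theta>\<^sub>0 M \<in> \<N>" "proj_dist (\<theta>\<^sub>0 M) M < 1" if "M \<in> \<M>" for M
    using nest_near_exists[OF \<M> \<N> less(1)] by metis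
  \<comment> \<open>Restriction gives the value \<open>undefined\<close> outside
    \<open>\<M>\<close>, as membership in the extensional function space requires.\<close>
  define \<theta> where "\<theta> = restrict \<theta>\<^sub>0 \<M>"
  have \<theta>N: "\<theta> M \<in> \<N>" and \<theta>1: "proj_dist (\<theta> M) M < 1" if "M \<in> \<M>" for M
    using \<theta>\<^sub>0 that by (auto simp: \<theta>_def)
  have \<theta>1': "proj_dist M (\<theta> M) < 1" if "M \<in> \<M>" for M
    using \<theta>1[OF that] proj_dist_commute by metis
  have image: "\<theta> ` \<M> = \<N>"
  proof
    show "\<N> \<subseteq> \<theta> ` \<M>"
    proof
      fix N assume N: "N \<in> \<N>"
      then obtain M where M: "M \<in> \<M>" "proj_dist M N < 1"
        using nest_near_exists[OF \<N> \<M> less(2)] by blast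
      then have "proj_dist N M < 1" by (metis proj_dist_commute)
      then have "N = \<theta> M" using nest_near_unique[OF \<M> \<N>] M N \<theta>N \<theta>1 by blast
      then show "N \<in> \<theta> ` \<M>" using M by blast
    qed
  qed (use \<theta>N in blast)
  have "inj_on \<theta> \<M>"
  proof (rule inj_onI)
    fix M\<^sub>1 M\<^sub>2 assume M: "M\<^sub>1 \<in> \<M>" "M\<^sub>2 \<in> \<M>" "\<theta> M\<^sub>1 = \<theta> M\<^sub>2"
    \<comment> \<open>With the nests exchanged, \<open>M\<^sub>1\<close> and
      \<open>M\<^sub>2\<close> are both near the single element \<open>\<theta> M\<^sub>1\<close> of
      \<open>\<N>\<close>.\<close>
    have "proj_dist M\<^sub>2 (\<theta> M\<^sub>1) < 1" unfolding M(3) by (rule \<theta>1'[OF M(2)])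
    with \<theta>1'[OF M(1)] show "M\<^sub>1 = M\<^sub>2"
      by (rule nest_near_unique[OF \<N> \<M> \<theta>N[OF M(1)] M(1,2)])
  qed
  moreover have "mono_on \<M> \<theta>"
  proof (rule mono_onI)
    fix M\<^sub>1 M\<^sub>2 assume M: "M\<^sub>1 \<in> \<M>" "M\<^sub>2 \<in> \<M>" "M\<^sub>1 \<subseteq> M\<^sub>2"
    show "\<theta> M\<^sub>1 \<subseteq> \<theta> M\<^sub>2"
      by (rule proj_dist_less_1_mono[of M\<^sub>1 M\<^sub>2])
        (intro M csubM csubN nest_total[OF \<N>] \<theta>N \<theta>1)+
  qed
  moreover have "\<theta> \<in> \<M> \<rightarrow>\<^sub>E \<N>" using \<theta>N by (auto simp: \<theta>_def)
  ultimately have iso: "nest_iso \<M> \<N> \<theta>"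
    using image by (simp add: nest_iso_def bij_betw_def)
  \<comment> \<open>Each infimum is attained at the partner under \<open>\<theta>\<close>. Both
    suprema in \<open>nest_dist\<close> therefore equal \<open>dist_to_id \<M> \<theta>\<close>, the
    second after reindexing \<open>\<N>\<close> as the image of \<open>\<theta>\<close>.\<close>
  have "(SUP M\<in>\<M>. INF N\<in>\<N>. proj_dist N M) = dist_to_id \<M> \<theta>"
    unfolding dist_to_id_def
    by (intro SUP_cong refl INF_proj_dist_eq[OF \<M> \<N>] \<theta>N \<theta>1)
  moreover have "(SUP N\<in>\<N>. INF M\<in>\<M>. proj_dist N M) = dist_to_id \<M> \<theta>"
  proof -
    have "(INF M'\<in>\<M>. proj_dist (\<theta> M) M') = proj_dist (\<theta> M) M" if "M \<in> \<M>" for M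
      using INF_proj_dist_eq[OF \<N> \<M> \<theta>N[OF that] that \<theta>1'[OF that]]
      by (simp add: proj_dist_commute)
    then show ?thesis
      unfolding dist_to_id_def image[symmetric] image_image by (intro SUP_cong refl)
  qed
  ultimately have dist: "dist_to_id \<M> \<theta> = \<gamma>"
    using assms(4) by (simp add: nest_dist_def)
  have unique: "\<phi> = \<theta>" if \<phi>: "nest_iso \<M> \<N> \<phi>" "dist_to_id \<M> \<phi> = \<gamma>" for \<phi>
  proof (rule PiE_ext)
    show E: "\<phi> \<in> \<M> \<rightarrow>\<^sub>E \<N>" "\<theta> \<in> \<M> \<rightarrow>\<^sub>E \<N>"
      using \<phi> iso by (auto simp: nest_iso_def)
    fix M assume M: "M \<in> \<M>"
    \<comment> \<open>The value \<gamma> < 1 bounds every single distance, so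
      \<open>\<phi> M\<close> is the one element of \<open>\<N>\<close> near
      \<open>M\<close>.\<close>
    have sub: "\<phi> ` \<M> \<subseteq> \<N>" using E(1) by blast
    then have "proj_dist (\<phi> M) M < 1"
      using proj_dist_le_dist_to_id[OF \<M> \<N> sub M] \<phi>(2) assms(5) by simp
    then show "\<phi> M = \<theta> M"
      using nest_near_unique[OF \<M> \<N>] M \<theta>N \<theta>1 sub by blast
  qed
  have "preserves_dimension \<M> \<theta>"
    unfolding preserves_dimension_def
  proof (intro ballI impI)
    fix M\<^sub>1 M\<^sub>2 assume M: "M\<^sub>1 \<in> \<M>" "M\<^sub>2 \<in> \<M>" "M\<^sub>1 \<subset> M\<^sub>2"
    then have "\<theta> M\<^sub>1 \<subseteq> \<theta> M\<^sub>2" using iso by (auto simp: nest_iso_def dest: mono_onD)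
    with M show "op_rank (\<lambda>x. orth_proj M\<^sub>2 x - orth_proj M\<^sub>1 x) =
        op_rank (\<lambda>x. orth_proj (\<theta> M\<^sub>2) x - orth_proj (\<theta> M\<^sub>1) x)"
      by (intro op_rank_diff_eq bij_betw_orth_proj csubM csubN \<theta>N \<theta>1) auto
  qed
  then show ?thesis using iso dist unique by blast
qed

end
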